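(* Let $\lambda_1,\lambda_2,\lambda_3\in\mathbb{R}$, let $\mathbb{K}$ be the associated algebra of 3-parameter generalized quaternions, and let $S_{\mathbb{K}}=\{p\in\mathbb{K}:N_p=1\}$. For $i=1,2,3$ let $X_i$ be the left-invariant vector field on $S_{\mathbb{K}}$ given by $X_i(p)=pe_i$. Then $$[X_1,X_2]=2\lambda_1X_3,\qquad [X_2,X_3]=2\lambda_3X_1,\qquad [X_3,X_1]=2\lambda_2X_2,$$ and consequently the Lie bracket on the Lie algebra $T_{S_{\mathbb{K}}}(e)=\mathrm{Im}(\mathbb{K})$ satisfies $$[e_1,e_2]=2\lambda_1e_3,\qquad [e_2,e_3]=2\lambda_3e_1,\qquad [e_3,e_1]=2\lambda_2e_2.$$
   Context: Given $\lambda_1,\lambda_2,\lambda_3\in\mathbb{R}$, $\mathbb{K}$ is the (associative, unital) real algebra with vector-space basis $1,e_1,e_2,e_3$, unit $1$, and bilinear multiplication determined by $e_1^2=-\lambda_1\lambda_2$, $e_2^2=-\lambda_1\lambda_3$, $e_3^2=-\lambda_2\lambda_3$, $e_1e_2=\lambda_1e_3=-e_2e_1$, $e_2e_3=\lambda_3e_1=-e_3e_2$, $e_3e_1=\lambda_2e_2=-e_1e_3$. For $p=a_0+a_1e_1+a_2e_2+a_3e_3\in\mathbb{K}$ (with $a_i\in\mathbb{R}$), the norm is $N_p=a_0^2+\lambda_1\lambda_2a_1^2+\lambda_1\lambda_3a_2^2+\lambda_2\lambda_3a_3^2$. $S_{\mathbb{K}}$ is a 3-dimensional Lie group under the multiplication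 of $\mathbb{K}$ (an embedded submanifold of $\mathbb{K}\cong\mathbb{R}^4$) with identity $e=1$ and $T_{S_{\mathbb{K}}}(e)=\mathrm{Im}(\mathbb{K})=\mathrm{span}\{e_1,e_2,e_3\}$. The bracket of vector fields is $[X,Y]=D_XY-D_YX$, with $D$ the standard flat derivative of $\mathbb{R}^4$ (the formulas for $X_i$ extend to all of $\mathbb{K}$), and the bracket on $T_{S_{\mathbb{K}}}(e)$ is the one transported from left-invariant vector fields by evaluation at $e$. *)

theory Defs
  imports "HOL-Analysis.Analysis"
begin

text \<open>
  The underlying vector space is \<^typ>\<open>real^4\<close>, indexed by \<open>0, 1, 2, 3 :: 4\<close>
  (in the type \<open>4\<close> the numeral \<open>4\<close> denotes the same index as \<open>0\<close>), so that
  \<open>p $ i\<close> is the coefficient of \<open>p\<close> at \<open>e\<^sub>i\<close> and \<open>gq_e 0\<close> is the unit.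
\<close>

definition gq_e :: "4 \<Rightarrow> real^4" where
  "gq_e i = axis i 1"

definition gq_table :: "real \<Rightarrow> real \<Rightarrow> real \<Rightarrow> 4 \<Rightarrow> 4 \<Rightarrow> real^4" where
  "gq_table l1 l2 l3 i j =
    (if i = 0 then gq_e j
     else if j = 0 then gq_e i
     else if i = 1 \<and> j = 1 then - (l1 * l2) *\<^sub>R gq_e 0
     else if i = 2 \<and> j = 2 then - (l1 * l3) *\<^sub>R gq_e 0
     else if i = 3 \<and> j = 3 then - (l2 * l3) *\<^sub>R gq_e 0
     else if i = 1 \<and> j = 2 then l1 *\<^sub>R gq_e 3
     else if i = 2 \<and> j = 1 then - l1 *\<^sub>R gq_e 3
     else if i = 2 \<and> j = 3 then l3 *\<^sub>R gq_e 1
     else if i = 3 \<and> j = 2 then - l3 *\<^sub>R gq_e 1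
     else if i = 3 \<and> j = 1 then l2 *\<^sub>R gq_e 2
     else - l2 *\<^sub>R gq_e 2)"

definition gq_mult :: "real \<Rightarrow> real \<Rightarrow> real \<Rightarrow> real^4 \<Rightarrow> real^4 \<Rightarrow> real^4" where
  "gq_mult l1 l2 l3 p q = (\<Sum>i\<in>UNIV. \<Sum>j\<in>UNIV. (p $ i * q $ j) *\<^sub>R gq_table l1 l2 l3 i j)"

definition gq_norm :: "real \<Rightarrow> real \<Rightarrow> real \<Rightarrow> real^4 \<Rightarrow> real" where
  "gq_norm l1 l2 l3 p =
    (p $ 0)\<^sup>2 + l1 * l2 * (p $ 1)\<^sup>2 + l1 * l3 * (p $ 2)\<^sup>2 + l2 * l3 * (p $ 3)\<^sup>2"

definition gq_sphere :: "real \<Rightarrow> real \<Rightarrow> real \<Rightarrow> (real^4) set" where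
  "gq_sphere l1 l2 l3 = {p. gq_norm l1 l2 l3 p = 1}"

definition gq_Im :: "(real^4) set" where
  "gq_Im = span {gq_e 1, gq_e 2, gq_e 3}"

lemma gq_index_4: "(4::4) = 0"
  by simp

lemma gq_index_exhaust: "i = 0 \<or> i = 1 \<or> i = 2 \<or> i = (3::4)"
  using exhaust_4[of i] unfolding gq_index_4 by blast

lemma gq_mult_e: "gq_mult l1 l2 l3 (gq_e i) (gq_e j) = gq_table l1 l2 l3 i j"
proof -
  have "(\<Sum>j'\<in>UNIV. (gq_e i $ i' * gq_e j $ j') *\<^sub>R gq_table l1 l2 l3 i' j')
      = (\<Sum>j'\<in>UNIV. if j' = j then gq_e i $ i' *\<^sub>R gq_table l1 l2 l3 i' j else 0)" for i'
    by (rule sum.cong) (simp_all add: gq_e_def axis_def)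
  then have "gq_mult l1 l2 l3 (gq_e i) (gq_e j)
      = (\<Sum>i'\<in>UNIV. gq_e i $ i' *\<^sub>R gq_table l1 l2 l3 i' j)"
    by (simp add: gq_mult_def)
  also have "\<dots> = (\<Sum>i'\<in>UNIV. if i' = i then gq_table l1 l2 l3 i j else 0)"
    by (rule sum.cong) (simp_all add: gq_e_def axis_def)
  finally show ?thesis
    by simp
qed

lemma gq_sum: "sum f (UNIV :: 4 set) = f 0 + f 1 + f 2 + f 3"
  unfolding sum_4 gq_index_4 by (simp add: ac_simps)

lemma gq_mult_component:
  "gq_mult l1 l2 l3 p q $ 0 =
     p$0 * q$0 - l1*l2 * (p$1 * q$1) - l1*l3 * (p$2 * q$2) - l2*l3 * (p$3 * q$3)"
  "gq_mult l1 l2 l3 p q $ 1 = p$0 * q$1 + p$1 * q$0 + l3 * (p$2 * q$3 - p$3 * q$2)"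
  "gq_mult l1 l2 l3 p q $ 2 = p$0 * q$2 + p$2 * q$0 + l2 * (p$3 * q$1 - p$1 * q$3)"
  "gq_mult l1 l2 l3 p q $ 3 = p$0 * q$3 + p$3 * q$0 + l1 * (p$1 * q$2 - p$2 * q$1)"
  by (simp_all add: gq_mult_def gq_sum gq_table_def gq_e_def axis_def algebra_simps)

lemma gq_vec_eqI:
  fixes p q :: "real^4"
  assumes "p $ 0 = q $ 0" "p $ 1 = q $ 1" "p $ 2 = q $ 2" "p $ 3 = q $ 3"
  shows "p = q"
  unfolding vec_eq_iff
proof
  fix i
  show "p $ i = q $ i"
    using gq_index_exhaust[of i] assms by (elim disjE) simp_all
qed

lemma gq_mult_bilinear: "bilinear (gq_mult l1 l2 l3)"
  unfolding bilinear_def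
  by (intro conjI allI linearI gq_vec_eqI) (simp_all add: gq_mult_component algebra_simps)

lemma gq_mult_assoc:
  "gq_mult l1 l2 l3 (gq_mult l1 l2 l3 p q) r = gq_mult l1 l2 l3 p (gq_mult l1 l2 l3 q r)"
  by (rule gq_vec_eqI) (simp_all add: gq_mult_component algebra_simps)

lemma gq_mult_one: "gq_mult l1 l2 l3 (gq_e 0) p = p" "gq_mult l1 l2 l3 p (gq_e 0) = p"
  by (rule gq_vec_eqI; simp add: gq_mult_component gq_e_def axis_def)+

lemma gq_norm_mult:
  "gq_norm l1 l2 l3 (gq_mult l1 l2 l3 p q) = gq_norm l1 l2 l3 p * gq_norm l1 l2 l3 q"
  by (simp add: gq_norm_def gq_mult_component power2_eq_square algebra_simps)

text \<open>
  For an embedded submanifold \<open>M\<close> of a Euclidean space, the tangent space at \<open>p\<close> consists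
  of the velocities at time \<open>0\<close> of the \<open>C\<^sup>1\<close> curves in \<open>M\<close> through \<open>p\<close>.
\<close>

definition tangent_space :: "'a::euclidean_space set \<Rightarrow> 'a \<Rightarrow> 'a set" where
  "tangent_space M p =
    {v. \<exists>\<epsilon>>0. \<exists>\<gamma>. \<gamma> C1_differentiable_on {-\<epsilon><..<\<epsilon>} \<and> \<gamma> ` {-\<epsilon><..<\<epsilon>} \<subseteq> M \<and>
       \<gamma> 0 = p \<and> (\<gamma> has_vector_derivative v) (at 0)}"

text \<open>
  A vector field on \<open>M\<close> is represented by a differentiable field on the whole ambient space
  that is tangent to \<open>M\<close> along \<open>M\<close>.  The value of the bracket of two such fields
  at a point of \<open>M\<close> depends only on their restrictions to \<open>M\<close>.
\<close>

definition vector_field_on :: "'a::euclidean_space set \<Rightarrow> ('a \<Rightarrow> 'a) \<Rightarrow> bool" where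
  "vector_field_on M X \<longleftrightarrow> X differentiable_on UNIV \<and> (\<forall>p\<in>M. X p \<in> tangent_space M p)"

definition flat_derivative :: "('a::euclidean_space \<Rightarrow> 'a) \<Rightarrow> ('a \<Rightarrow> 'a) \<Rightarrow> 'a \<Rightarrow> 'a" where
  "flat_derivative X Y p = frechet_derivative Y (at p) (X p)"

definition vf_bracket :: "('a::euclidean_space \<Rightarrow> 'a) \<Rightarrow> ('a \<Rightarrow> 'a) \<Rightarrow> 'a \<Rightarrow> 'a" where
  "vf_bracket X Y p = flat_derivative X Y p - flat_derivative Y X p"

definition gq_left_invariant :: "real \<Rightarrow> real \<Rightarrow> real \<Rightarrow> (real^4 \<Rightarrow> real^4) \<Rightarrow> bool" where
  "gq_left_invariant l1 l2 l3 X \<longleftrightarrow>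
    vector_field_on (gq_sphere l1 l2 l3) X \<and>
    (\<forall>q\<in>gq_sphere l1 l2 l3. \<forall>p\<in>gq_sphere l1 l2 l3.
       frechet_derivative (gq_mult l1 l2 l3 q) (at p) (X p) = X (gq_mult l1 l2 l3 q p))"

text \<open>
  The bracket on the tangent space at the identity \<open>gq_e 0\<close>, transported from left-invariant
  fields by evaluation; it is meaningful only for \<open>u\<close> and \<open>v\<close> tangent at the identity.
\<close>

definition gq_lie_bracket :: "real \<Rightarrow> real \<Rightarrow> real \<Rightarrow> real^4 \<Rightarrow> real^4 \<Rightarrow> real^4" where
  "gq_lie_bracket l1 l2 l3 u v =
    (THE w. \<exists>X Y. gq_left_invariant l1 l2 l3 X \<and> gq_left_invariant l1 l2 l3 Y \<and>
       X (gq_e 0) = u \<and> Y (gq_e 0) = v \<and> w = vf_bracket X Y (gq_e 0))"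

definition gq_X :: "real \<Rightarrow> real \<Rightarrow> real \<Rightarrow> 4 \<Rightarrow> real^4 \<Rightarrow> real^4" where
  "gq_X l1 l2 l3 i p = gq_mult l1 l2 l3 p (gq_e i)"

end

theory Submission
  imports Defs
begin

text \<open>
  Everything reduces to the commutator of the algebra.  For \<open>u\<close> in \<open>Im(K)\<close> the field
  \<open>p \<mapsto> p u\<close> is the restriction of a linear map, so its flat derivative is the map itself, and
  associativity turns the bracket of \<open>p \<mapsto> p u\<close> and \<open>p \<mapsto> p v\<close> into
  \<open>p \<mapsto> p (u v - v u)\<close> (\<open>vf_bracket_right_mult\<close>).  The multiplication table then gives
  the structure constants.

  The geometric input is that enough curves lie in the norm-one set.  An imaginary \<open>u\<close> satisfies
  \<open>u u = - N(u)\<close>, hence the rational parametrisation of the conic \<open>x\<^sup>2 + N(u) y\<^sup>2 = 1\<close> produces a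
  curve through \<open>1\<close> with velocity \<open>u\<close>, whatever the sign of \<open>N(u)\<close>
  (\<open>gq_sphere_curve\<close>).  Multiplying it on the left by \<open>p\<close>, which preserves the norm, makes
  \<open>p u\<close> tangent at \<open>p\<close>.  Conversely, differentiating \<open>N = 1\<close> along a curve through \<open>1\<close> kills
  the real part of its velocity, so the tangent space at \<open>1\<close> is exactly \<open>Im(K)\<close>.

  For the bracket on the tangent space, left invariance forces \<open>X(q) = q X(1)\<close> on the
  norm-one set, but off that set an extension is arbitrary.  The bracket at \<open>1\<close> is nevertheless
  determined, because the field is only differentiated in a direction tangent to the set, and this
  derivative can be computed along a curve inside it (\<open>left_invariant_derivative_one\<close>).
\<close>

section \<open>The product, the imaginary part and the norm-one set\<close>

lemma gq_mult_bounded_bilinear: "bounded_bilinear (gq_mult l1 l2 l3)"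
  using gq_mult_bilinear bilinear_conv_bounded_bilinear by blast

lemmas gq_mult_bounded_linear_left =
  bounded_bilinear.bounded_linear_left [OF gq_mult_bounded_bilinear]

lemmas gq_mult_bounded_linear_right =
  bounded_bilinear.bounded_linear_right [OF gq_mult_bounded_bilinear]

lemma gq_e_component: "gq_e i $ j = (if j = i then 1 else 0)"
  by (simp add: gq_e_def axis_def)

lemma gq_Im_iff: "v \<in> gq_Im \<longleftrightarrow> v $ 0 = 0"
proof
  assume "v \<in> gq_Im"
  then have "v \<in> span {gq_e 1, gq_e 2, gq_e 3}"
    by (simp add: gq_Im_def)
  then show "v $ 0 = 0"
    by (induction rule: span_induct_alt) (auto simp: gq_e_component)
next
  assume "v $ 0 = 0"
  then have "v = v $ 1 *\<^sub>R gq_e 1 + v $ 2 *\<^sub>R gq_e 2 + v $ 3 *\<^sub>R gq_e 3"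
    by (intro gq_vec_eqI) (simp_all add: gq_e_component)
  moreover have "\<dots> \<in> gq_Im"
    unfolding gq_Im_def by (intro span_add span_scale span_base) auto
  ultimately show "v \<in> gq_Im"
    by simp
qed

lemma gq_one_in_sphere: "gq_e 0 \<in> gq_sphere l1 l2 l3"
  by (simp add: gq_sphere_def gq_norm_def gq_e_component)

lemma gq_mult_in_sphere:
  "p \<in> gq_sphere l1 l2 l3 \<Longrightarrow> q \<in> gq_sphere l1 l2 l3 \<Longrightarrow>
    gq_mult l1 l2 l3 p q \<in> gq_sphere l1 l2 l3"
  by (simp add: gq_sphere_def gq_norm_mult)

section \<open>Curves in the norm-one set\<close>

text \<open>
  The curve is \<open>(1 - m + t v) / (1 + m)\<close> with \<open>m = N(v) t\<^sup>2 / 4\<close>, the Cayley transform of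
  \<open>t v / 2\<close>; its norm is \<open>((1 - m)\<^sup>2 + 4 m) / (1 + m)\<^sup>2 = 1\<close>.  Unlike the one-parameter subgroup
  generated by \<open>v\<close>, it needs no distinction between elliptic, parabolic and hyperbolic directions.
\<close>

lemma gq_sphere_curve:
  assumes "v \<in> gq_Im"
  obtains \<epsilon> \<gamma> where "\<epsilon> > 0" "\<gamma> C1_differentiable_on {-\<epsilon><..<\<epsilon>}"
    "\<gamma> ` {-\<epsilon><..<\<epsilon>} \<subseteq> gq_sphere l1 l2 l3" "\<gamma> 0 = gq_e 0"
    "(\<gamma> has_vector_derivative v) (at 0)"
proof -
  define n where "n = gq_norm l1 l2 l3 v"
  define m where "m t = n * t\<^sup>2 / 4" for t
  define c where "c t = (1 - m t) / (1 + m t)" for t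
  define s where "s t = t / (1 + m t)" for t
  define c' where "c' t = - n * t / (1 + m t)\<^sup>2" for t
  define s' where "s' t = (1 - m t) / (1 + m t)\<^sup>2" for t
  define \<gamma> where "\<gamma> t = c t *\<^sub>R gq_e 0 + s t *\<^sub>R v" for t
  define D where "D t = c' t *\<^sub>R gq_e 0 + s' t *\<^sub>R v" for t
  \<comment> \<open>Small enough for \<open>1 + m t\<close> to stay positive even if \<open>n < 0\<close>.\<close>
  define \<epsilon> where "\<epsilon> = 1 / (1 + \<bar>n\<bar>)"
  have "\<epsilon> > 0"
    by (simp add: \<epsilon>_def add_pos_nonneg)
  have pos: "1 + m t > 0" if "t \<in> {-\<epsilon><..<\<epsilon>}" for t
  proof -
    have "\<bar>t\<bar> \<le> \<epsilon>" "\<epsilon> \<le> 1"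
      using that by (auto simp: \<epsilon>_def)
    then have "t\<^sup>2 \<le> \<epsilon>"
      using mult_mono[of "\<bar>t\<bar>" \<epsilon> "\<bar>t\<bar>" 1] by (simp add: power2_eq_square)
    then have "\<bar>n\<bar> * t\<^sup>2 \<le> \<bar>n\<bar> * \<epsilon>"
      by (simp add: mult_left_mono)
    also have "\<dots> \<le> 1"
      by (simp add: \<epsilon>_def divide_simps)
    finally have "\<bar>n * t\<^sup>2\<bar> \<le> 1"
      by (simp add: abs_mult)
    then show ?thesis
      by (auto simp: m_def)
  qed
  have m_deriv: "(m has_real_derivative n * t / 2) (at t)" for t
    unfolding m_def by (auto intro!: derivative_eq_intros)
  have c_deriv: "(c has_real_derivative c' t) (at t)" if "t \<in> {-\<epsilon><..<\<epsilon>}" for t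
  proof -
    have "(c has_real_derivative
        ((0 - n * t / 2) * (1 + m t) - (1 - m t) * (0 + n * t / 2)) / ((1 + m t) * (1 + m t))) (at t)"
      unfolding c_def using pos[OF that]
      by (intro DERIV_divide DERIV_diff DERIV_add DERIV_const m_deriv) simp
    moreover have "(0 - n * t / 2) * (1 + m t) - (1 - m t) * (0 + n * t / 2) = - n * t"
      by (simp add: field_simps)
    ultimately show ?thesis
      by (simp add: c'_def power2_eq_square)
  qed
  have s_deriv: "(s has_real_derivative s' t) (at t)" if "t \<in> {-\<epsilon><..<\<epsilon>}" for t
  proof -
    have "(s has_real_derivative
        (1 * (1 + m t) - t * (0 + n * t / 2)) / ((1 + m t) * (1 + m t))) (at t)"
      unfolding s_def using pos[OF that]
      by (intro DERIV_divide DERIV_ident DERIV_add DERIV_const m_deriv) simp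
    then show ?thesis
      by (rule DERIV_cong) (simp add: s'_def m_def power2_eq_square)
  qed
  have \<gamma>_deriv: "(\<gamma> has_vector_derivative D t) (at t)" if "t \<in> {-\<epsilon><..<\<epsilon>}" for t
  proof -
    have "(\<gamma> has_vector_derivative (c t *\<^sub>R 0 + c' t *\<^sub>R gq_e 0) + (s t *\<^sub>R 0 + s' t *\<^sub>R v)) (at t)"
      unfolding \<gamma>_def
      by (intro has_vector_derivative_add has_vector_derivative_scaleR c_deriv s_deriv that
          has_vector_derivative_const)
    then show ?thesis
      by (simp add: D_def)
  qed
  have "continuous_on {-\<epsilon><..<\<epsilon>} m"
    unfolding m_def by (intro continuous_intros) simp
  then have "continuous_on {-\<epsilon><..<\<epsilon>} D"
    unfolding D_def c'_def s'_def using pos by (intro continuous_intros) fastforce+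
  with \<gamma>_deriv have "\<gamma> C1_differentiable_on {-\<epsilon><..<\<epsilon>}"
    unfolding C1_differentiable_on_def by blast
  moreover have "\<gamma> t \<in> gq_sphere l1 l2 l3" if "t \<in> {-\<epsilon><..<\<epsilon>}" for t
  proof -
    have "gq_norm l1 l2 l3 (\<gamma> t) = (c t)\<^sup>2 + n * (s t)\<^sup>2"
      using assms
      by (simp add: gq_norm_def \<gamma>_def n_def gq_e_component gq_Im_iff power_mult_distrib algebra_simps)
    also have "\<dots> = ((1 - m t)\<^sup>2 + n * t\<^sup>2) / (1 + m t)\<^sup>2"
      by (simp add: c_def s_def power_divide add_divide_distrib)
    also have "(1 - m t)\<^sup>2 + n * t\<^sup>2 = (1 + m t)\<^sup>2"
      by (simp add: m_def power2_eq_square algebra_simps)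
    also have "(1 + m t)\<^sup>2 / (1 + m t)\<^sup>2 = 1"
      using pos[OF that] by simp
    finally show ?thesis
      by (simp add: gq_sphere_def)
  qed
  moreover have "\<gamma> 0 = gq_e 0"
    by (simp add: \<gamma>_def c_def s_def m_def)
  moreover have "(\<gamma> has_vector_derivative v) (at 0)"
    using \<gamma>_deriv[of 0] \<open>\<epsilon> > 0\<close> by (simp add: D_def c'_def s'_def m_def)
  ultimately show thesis
    using that[of \<epsilon> \<gamma>] \<open>\<epsilon> > 0\<close> by blast
qed

text \<open>Left multiplication by \<open>p\<close> is linear and preserves the norm-one set, so it carries a curve
  through \<open>1\<close> with velocity \<open>v\<close> to one through \<open>p\<close> with velocity \<open>p v\<close>.\<close>

lemma gq_mult_in_tangent_space:
  assumes "p \<in> gq_sphere l1 l2 l3" and "v \<in> gq_Im"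
  shows "gq_mult l1 l2 l3 p v \<in> tangent_space (gq_sphere l1 l2 l3) p"
proof -
  let ?L = "gq_mult l1 l2 l3 p"
  obtain \<epsilon> \<gamma> where \<gamma>: "\<epsilon> > 0" "\<gamma> C1_differentiable_on {-\<epsilon><..<\<epsilon>}"
    "\<gamma> ` {-\<epsilon><..<\<epsilon>} \<subseteq> gq_sphere l1 l2 l3" "\<gamma> 0 = gq_e 0"
    "(\<gamma> has_vector_derivative v) (at 0)"
    using gq_sphere_curve[OF assms(2)] by blast
  obtain D where D: "\<And>t. t \<in> {-\<epsilon><..<\<epsilon>} \<Longrightarrow> (\<gamma> has_vector_derivative D t) (at t)"
    "continuous_on {-\<epsilon><..<\<epsilon>} D"
    using \<gamma>(2) unfolding C1_differentiable_on_def by blast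
  have L: "bounded_linear ?L"
    by (rule gq_mult_bounded_linear_right)
  have "(\<lambda>t. ?L (\<gamma> t)) C1_differentiable_on {-\<epsilon><..<\<epsilon>}"
    unfolding C1_differentiable_on_def
    by (intro exI[of _ "\<lambda>t. ?L (D t)"] conjI ballI bounded_linear.has_vector_derivative[OF L D(1)]
        bounded_linear.continuous_on[OF L D(2)])
  moreover have "(\<lambda>t. ?L (\<gamma> t)) ` {-\<epsilon><..<\<epsilon>} \<subseteq> gq_sphere l1 l2 l3"
    using \<gamma>(3) assms(1) by (auto intro!: gq_mult_in_sphere)
  moreover have "?L (\<gamma> 0) = p"
    by (simp add: \<gamma>(4) gq_mult_one)
  moreover have "((\<lambda>t. ?L (\<gamma> t)) has_vector_derivative ?L v) (at 0)"
    by (rule bounded_linear.has_vector_derivative[OF L \<gamma>(5)])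
  ultimately show ?thesis
    unfolding tangent_space_def using \<gamma>(1) by blast
qed

text \<open>The derivative of the norm at \<open>1\<close> is twice the real part, which gives the inclusion of the
  tangent space in \<open>Im(K)\<close>.\<close>

lemma tangent_space_one: "tangent_space (gq_sphere l1 l2 l3) (gq_e 0) = gq_Im"
proof
  show "gq_Im \<subseteq> tangent_space (gq_sphere l1 l2 l3) (gq_e 0)"
    using gq_mult_in_tangent_space[OF gq_one_in_sphere] by (auto simp: gq_mult_one)
  show "tangent_space (gq_sphere l1 l2 l3) (gq_e 0) \<subseteq> gq_Im"
  proof
    fix v
    assume "v \<in> tangent_space (gq_sphere l1 l2 l3) (gq_e 0)"
    then obtain \<epsilon> \<gamma> where \<gamma>: "\<epsilon> > 0" "\<gamma> ` {-\<epsilon><..<\<epsilon>} \<subseteq> gq_sphere l1 l2 l3" "\<gamma> 0 = gq_e 0"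
      "(\<gamma> has_vector_derivative v) (at 0)"
      unfolding tangent_space_def by blast
    have comp: "((\<lambda>t. \<gamma> t $ i) has_real_derivative v $ i) (at 0)" for i
      using bounded_linear.has_vector_derivative[OF bounded_linear_vec_nth \<gamma>(4)]
      by (simp add: has_real_derivative_iff_has_vector_derivative)
    have "((\<lambda>t. gq_norm l1 l2 l3 (\<gamma> t)) has_real_derivative 2 * v $ 0) (at 0)"
      unfolding gq_norm_def
      by (auto intro!: derivative_eq_intros comp simp: \<gamma>(3) gq_e_component)
    moreover have "((\<lambda>t. gq_norm l1 l2 l3 (\<gamma> t)) has_real_derivative 0) (at 0)"
    proof (rule has_field_derivative_transform_within_open[where S = "{-\<epsilon><..<\<epsilon>}"])
      show "((\<lambda>t. 1) has_real_derivative 0) (at 0)"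
        by simp
      show "1 = gq_norm l1 l2 l3 (\<gamma> t)" if "t \<in> {-\<epsilon><..<\<epsilon>}" for t
        using \<gamma>(2) that by (simp add: gq_sphere_def image_subset_iff)
    qed (use \<gamma>(1) in auto)
    ultimately show "v \<in> gq_Im"
      using DERIV_unique by (fastforce simp: gq_Im_iff)
  qed
qed

section \<open>Left-invariant fields and their brackets\<close>

lemma left_invariant_right_mult:
  assumes "v \<in> gq_Im"
  shows "gq_left_invariant l1 l2 l3 (\<lambda>p. gq_mult l1 l2 l3 p v)"
proof -
  have "frechet_derivative (gq_mult l1 l2 l3 q) (at p) = gq_mult l1 l2 l3 q" for p q
    using bounded_linear_imp_has_derivative[OF gq_mult_bounded_linear_right]
    by (rule frechet_derivative_at[symmetric])
  moreover have "(\<lambda>p. gq_mult l1 l2 l3 p v) differentiable_on UNIV"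
    using bounded_linear_imp_differentiable_on[OF gq_mult_bounded_linear_left] .
  ultimately show ?thesis
    using gq_mult_in_tangent_space[OF _ assms]
    by (simp add: gq_left_invariant_def vector_field_on_def gq_mult_assoc)
qed

lemma vf_bracket_right_mult:
  "vf_bracket (\<lambda>p. gq_mult l1 l2 l3 p u) (\<lambda>p. gq_mult l1 l2 l3 p v) p =
    gq_mult l1 l2 l3 p (gq_mult l1 l2 l3 u v - gq_mult l1 l2 l3 v u)"
proof -
  have "frechet_derivative (\<lambda>p. gq_mult l1 l2 l3 p w) (at p) = (\<lambda>p. gq_mult l1 l2 l3 p w)" for w
    using bounded_linear_imp_has_derivative[OF gq_mult_bounded_linear_left]
    by (rule frechet_derivative_at[symmetric])
  then show ?thesis
    by (simp add: vf_bracket_def flat_derivative_def gq_mult_assoc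
        bounded_bilinear.diff_right[OF gq_mult_bounded_bilinear])
qed

text \<open>Take \<open>p = 1\<close> in the invariance condition; left multiplication is its own derivative.\<close>

lemma left_invariant_eq_right_mult:
  assumes "gq_left_invariant l1 l2 l3 X" and "q \<in> gq_sphere l1 l2 l3"
  shows "X q = gq_mult l1 l2 l3 q (X (gq_e 0))"
proof -
  have "frechet_derivative (gq_mult l1 l2 l3 q) (at (gq_e 0)) = gq_mult l1 l2 l3 q"
    using bounded_linear_imp_has_derivative[OF gq_mult_bounded_linear_right]
    by (rule frechet_derivative_at[symmetric])
  with assms gq_one_in_sphere show ?thesis
    unfolding gq_left_invariant_def by (metis gq_mult_one(2))
qed

text \<open>
  The ambient field \<open>Y\<close> equals \<open>q \<mapsto> q Y(1)\<close> only on the norm-one set.  By the chain rule its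
  derivative in the direction \<open>u\<close> is the velocity of \<open>Y\<close> along any curve with velocity \<open>u\<close>;
  choosing that curve in the norm-one set, one may replace \<open>Y\<close> by \<open>q \<mapsto> q Y(1)\<close>.
\<close>

lemma left_invariant_derivative_one:
  assumes Y: "gq_left_invariant l1 l2 l3 Y" and u: "u \<in> gq_Im"
  shows "frechet_derivative Y (at (gq_e 0)) u = gq_mult l1 l2 l3 u (Y (gq_e 0))"
proof -
  obtain \<epsilon> \<gamma> where \<gamma>: "\<epsilon> > 0" "\<gamma> ` {-\<epsilon><..<\<epsilon>} \<subseteq> gq_sphere l1 l2 l3" "\<gamma> 0 = gq_e 0"
    "(\<gamma> has_vector_derivative u) (at 0)"
    by (rule gq_sphere_curve[OF u]) (rule that)
  have "Y differentiable (at (gq_e 0))"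
    using Y by (simp add: gq_left_invariant_def vector_field_on_def differentiable_on_def)
  then have "(Y has_derivative frechet_derivative Y (at (gq_e 0))) (at (gq_e 0))"
    by (simp add: frechet_derivative_works)
  then have "(Y has_derivative frechet_derivative Y (at (gq_e 0))) (at (\<gamma> 0) within range \<gamma>)"
    by (simp add: \<gamma>(3) has_derivative_at_withinI)
  then have dY: "((\<lambda>t. Y (\<gamma> t)) has_vector_derivative frechet_derivative Y (at (gq_e 0)) u) (at 0)"
    using vector_derivative_diff_chain_within[OF \<gamma>(4)] by (simp add: o_def)
  have "((\<lambda>t. gq_mult l1 l2 l3 (\<gamma> t) (Y (gq_e 0))) has_vector_derivative
      gq_mult l1 l2 l3 u (Y (gq_e 0))) (at 0)"
    by (rule bounded_linear.has_vector_derivative[OF gq_mult_bounded_linear_left \<gamma>(4)])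
  then have "((\<lambda>t. Y (\<gamma> t)) has_vector_derivative gq_mult l1 l2 l3 u (Y (gq_e 0))) (at 0)"
  proof (rule has_vector_derivative_transform_within_open[where S = "{-\<epsilon><..<\<epsilon>}"])
    show "gq_mult l1 l2 l3 (\<gamma> t) (Y (gq_e 0)) = Y (\<gamma> t)" if "t \<in> {-\<epsilon><..<\<epsilon>}" for t
      using left_invariant_eq_right_mult[OF Y, of "\<gamma> t"] \<gamma>(2) that by (simp add: image_subset_iff)
  qed (use \<gamma>(1) in auto)
  with dY show ?thesis
    by (rule vector_derivative_unique_at)
qed

text \<open>
  The fields \<open>p \<mapsto> p u\<close> and \<open>p \<mapsto> p v\<close> witness existence in the definite description;
  uniqueness is the preceding lemma applied to both fields.
\<close>

lemma gq_lie_bracket_eq_commutator: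
  assumes "u \<in> gq_Im" and "v \<in> gq_Im"
  shows "gq_lie_bracket l1 l2 l3 u v = gq_mult l1 l2 l3 u v - gq_mult l1 l2 l3 v u"
  unfolding gq_lie_bracket_def
proof (rule the_equality)
  show "\<exists>X Y. gq_left_invariant l1 l2 l3 X \<and> gq_left_invariant l1 l2 l3 Y \<and>
      X (gq_e 0) = u \<and> Y (gq_e 0) = v \<and>
      gq_mult l1 l2 l3 u v - gq_mult l1 l2 l3 v u = vf_bracket X Y (gq_e 0)"
    using left_invariant_right_mult[OF assms(1)] left_invariant_right_mult[OF assms(2)]
    by (intro exI[of _ "\<lambda>p. gq_mult l1 l2 l3 p u"] exI[of _ "\<lambda>p. gq_mult l1 l2 l3 p v"])
      (simp add: vf_bracket_right_mult gq_mult_one)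
qed (use assms in \<open>auto simp: vf_bracket_def flat_derivative_def left_invariant_derivative_one\<close>)

lemma gq_e_in_Im: "i \<noteq> 0 \<Longrightarrow> gq_e i \<in> gq_Im"
  by (simp add: gq_Im_iff gq_e_component)

lemma gq_e_commutators:
  "gq_mult l1 l2 l3 (gq_e 1) (gq_e 2) - gq_mult l1 l2 l3 (gq_e 2) (gq_e 1) = (2 * l1) *\<^sub>R gq_e 3"
  "gq_mult l1 l2 l3 (gq_e 2) (gq_e 3) - gq_mult l1 l2 l3 (gq_e 3) (gq_e 2) = (2 * l3) *\<^sub>R gq_e 1"
  "gq_mult l1 l2 l3 (gq_e 3) (gq_e 1) - gq_mult l1 l2 l3 (gq_e 1) (gq_e 3) = (2 * l2) *\<^sub>R gq_e 2"
  by (rule gq_vec_eqI; simp add: gq_mult_component gq_e_component)+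

theorem mainTheorem10:
  fixes l1 l2 l3 :: real
  shows
    "(\<forall>i\<in>{1, 2, 3}. gq_left_invariant l1 l2 l3 (gq_X l1 l2 l3 i)) \<and>
     (\<forall>p\<in>gq_sphere l1 l2 l3.
        vf_bracket (gq_X l1 l2 l3 1) (gq_X l1 l2 l3 2) p = (2 * l1) *\<^sub>R gq_X l1 l2 l3 3 p \<and>
        vf_bracket (gq_X l1 l2 l3 2) (gq_X l1 l2 l3 3) p = (2 * l3) *\<^sub>R gq_X l1 l2 l3 1 p \<and>
        vf_bracket (gq_X l1 l2 l3 3) (gq_X l1 l2 l3 1) p = (2 * l2) *\<^sub>R gq_X l1 l2 l3 2 p) \<and>
     tangent_space (gq_sphere l1 l2 l3) (gq_e 0) = gq_Im \<and>
     gq_lie_bracket l1 l2 l3 (gq_e 1) (gq_e 2) = (2 * l1) *\<^sub>R gq_e 3 \<and>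
     gq_lie_bracket l1 l2 l3 (gq_e 2) (gq_e 3) = (2 * l3) *\<^sub>R gq_e 1 \<and>
     gq_lie_bracket l1 l2 l3 (gq_e 3) (gq_e 1) = (2 * l2) *\<^sub>R gq_e 2"
proof -
  have X: "gq_X l1 l2 l3 i = (\<lambda>p. gq_mult l1 l2 l3 p (gq_e i))" for i
    by (simp add: gq_X_def fun_eq_iff)
  have "\<forall>i\<in>{1, 2, 3}. gq_left_invariant l1 l2 l3 (gq_X l1 l2 l3 i)"
    unfolding X by (auto intro!: left_invariant_right_mult gq_e_in_Im)
  then show ?thesis
    by (simp add: X vf_bracket_right_mult gq_e_commutators tangent_space_one
        gq_lie_bracket_eq_commutator gq_e_in_Im
        bounded_bilinear.scaleR_right[OF gq_mult_bounded_bilinear])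
qed

end
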